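(* Let $u\in\mathcal{K}$, with $E\subset(-\infty,0]$ the corresponding closed set, and write $E^c=\mathbb{C}\setminus E$. If \[ E^c\supset\bigcup_{n\ge 0}(-d_n,-c_n), \] where $0\le c_0<d_0<c_1<d_1<\cdots$, and $\limsup_{n\to\infty} d_n/c_n>1$, then \[ \frac{u(r)}{r^{1/2}}\to 0\quad\text{as } r\to\infty. \]
   Context: The class $\mathcal{K}$: a subharmonic function $u$ on $\mathbb{C}$ is in $\mathcal{K}$ if $u$ is continuous in $\mathbb{C}$ and positive harmonic in $D=\mathbb{C}\setminus E$, where $E\subset(-\infty,0]$ is a closed set on which $u$ vanishes, and each point of $E$ is regular for the Dirichlet problem in $D$. The set $E$ is called the closed set corresponding to $u$. Here $(-d_n,-c_n)$ denotes an open interval of the real line, and $r$ tends to infinity through positive real values. *)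

theory Defs
  imports "HOL-Analysis.Analysis"
begin

text \<open>The gradient of \<open>u\<close> is \<open>g\<close> and its Hessian is \<open>H\<close>; the last conjunct says that the Laplacian,
  i.e. the trace of the Hessian, vanishes.\<close>

definition harmonic_on :: "(complex \<Rightarrow> real) \<Rightarrow> complex set \<Rightarrow> bool" where
  "harmonic_on u S \<longleftrightarrow> open S \<and>
     (\<exists>(g :: complex \<Rightarrow> complex) (H :: complex \<Rightarrow> complex \<Rightarrow> complex).
        (\<forall>z\<in>S. (u has_derivative (\<lambda>h. g z \<bullet> h)) (at z)) \<and>
        (\<forall>z\<in>S. (g has_derivative H z) (at z)) \<and>
        (\<forall>h. continuous_on S (\<lambda>z. H z h)) \<and>
        (\<forall>z\<in>S. H z 1 \<bullet> 1 + H z \<i> \<bullet> \<i> = 0))"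

text \<open>Mean value of an extended real function over a circle, as the integral of the positive part
  minus that of the negative part (\<^const>\<open>e2ennreal\<close> truncates negative values to \<open>0\<close>). It is only
  used for functions bounded above on the circle, so \<open>\<infinity> - \<infinity>\<close> does not occur.\<close>

definition circle_mean :: "(complex \<Rightarrow> ereal) \<Rightarrow> complex \<Rightarrow> real \<Rightarrow> ereal" where
  "circle_mean v a r =
     (enn2ereal (\<integral>\<^sup>+t\<in>{0..2*pi}. e2ennreal (v (a + complex_of_real r * cis t)) \<partial>lborel)
      - enn2ereal (\<integral>\<^sup>+t\<in>{0..2*pi}. e2ennreal (- v (a + complex_of_real r * cis t)) \<partial>lborel))
     / ereal (2 * pi)"

text \<open>The function that is identically \<open>-\<infinity>\<close> is admitted.\<close>

definition subharmonic_on :: "(complex \<Rightarrow> ereal) \<Rightarrow> complex set \<Rightarrow> bool" where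
  "subharmonic_on v S \<longleftrightarrow> open S \<and>
     (\<forall>z\<in>S. v z < \<infinity>) \<and>
     (\<forall>z\<in>S. \<forall>c. v z < c \<longrightarrow> (\<forall>\<^sub>F w in at z. v w < c)) \<and>
     (\<forall>a r. r > 0 \<and> cball a r \<subseteq> S \<longrightarrow> v a \<le> circle_mean v a r)"

text \<open>The Dirichlet problem is posed in the Riemann sphere: if \<open>D\<close> is unbounded, then \<open>\<infinity>\<close> is
  a boundary point of \<open>D\<close>, and \<open>L\<close> is the boundary value prescribed there. If \<open>D\<close> is bounded, the filter
  in the last conjunct is trivial and the condition is void.\<close>

definition perron_family ::
    "complex set \<Rightarrow> (complex \<Rightarrow> real) \<Rightarrow> real \<Rightarrow> (complex \<Rightarrow> ereal) set" where
  "perron_family D \<phi> L =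
     {v. subharmonic_on v D \<and>
         (\<forall>\<zeta>\<in>frontier D. Limsup (at \<zeta> within D) v \<le> ereal (\<phi> \<zeta>)) \<and>
         Limsup (inf at_infinity (principal D)) v \<le> ereal L}"

definition perron_solution ::
    "complex set \<Rightarrow> (complex \<Rightarrow> real) \<Rightarrow> real \<Rightarrow> complex \<Rightarrow> ereal" where
  "perron_solution D \<phi> L z = (SUP v\<in>perron_family D \<phi> L. v z)"

text \<open>A pair \<open>\<phi>\<close>, \<open>L\<close> as below is exactly a continuous function on the boundary of \<open>D\<close> in the Riemann
  sphere.\<close>

definition dirichlet_regular :: "complex set \<Rightarrow> complex \<Rightarrow> bool" where
  "dirichlet_regular D \<zeta> \<longleftrightarrow> \<zeta> \<in> frontier D \<and>
     (\<forall>\<phi> L. continuous_on (frontier D) \<phi> \<and>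
            (\<phi> \<longlongrightarrow> L) (inf at_infinity (principal (frontier D))) \<longrightarrow>
            (perron_solution D \<phi> L \<longlongrightarrow> ereal (\<phi> \<zeta>)) (at \<zeta> within D))"

text \<open>\<open>class_K u E\<close>: \<open>u\<close> belongs to the class \<open>K\<close>, and \<open>E\<close> is the corresponding closed set.\<close>

definition class_K :: "(complex \<Rightarrow> real) \<Rightarrow> complex set \<Rightarrow> bool" where
  "class_K u E \<longleftrightarrow>
     subharmonic_on (\<lambda>z. ereal (u z)) UNIV \<and>
     continuous_on UNIV u \<and>
     closed E \<and> E \<subseteq> complex_of_real ` {..0} \<and>
     (\<forall>z\<in>E. u z = 0) \<and>
     harmonic_on u (- E) \<and> (\<forall>z\<in>- E. u z > 0) \<and>
     (\<forall>\<zeta>\<in>E. dirichlet_regular (- E) \<zeta>)"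

end

theory Submission
  imports Defs "HOL-Complex_Analysis.Conformal_Mappings"
begin

text \<open>
  The substitution \<open>z = w\<^sup>2\<close> maps the right half plane onto the plane slit along the negative axis, so
  \<open>h w = u (w\<^sup>2)\<close> is a positive harmonic function on the half plane. The slit plane is starlike, so
  \<open>u\<close> is there the real part of a holomorphic function
  (\<open>harmonic_on_starlike_eq_Re_holomorphic\<close>), and so is \<open>h\<close>. A positive harmonic function on a half
  plane has an angular derivative at infinity: with \<open>a = inf h w / Re w\<close>, the quotient \<open>h (x w) / x\<close> tends
  to \<open>a * Re w\<close> as the real \<open>x\<close> grows, for each \<open>w\<close> (\<open>angular_derivative_at_infinity\<close>). For \<open>w = 1\<close>
  this says that \<open>u r / sqrt r\<close> converges to \<open>a\<close>, whatever \<open>E\<close> is; the gaps have to force \<open>a = 0\<close>.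

  There is a \<open>q > 1\<close> such that \<open>d n > q * c n\<close> for infinitely many \<open>n\<close>. Rescaled by \<open>c n\<close>, the
  corresponding gap contains \<open>(-q, -1)\<close>, so the rescaled \<open>u\<close> is positive and harmonic in the
  disc with diameter \<open>(-q, -1)\<close>, and Harnack's inequality bounds its values at two points near the centre
  of this disc by each other, with a constant independent of \<open>n\<close>. On the other hand, off the negative
  axis the rescaled \<open>u\<close> is close to \<open>a * Re (sqrt z)\<close>, which tends to zero when \<open>z\<close> approaches
  the centre. If \<open>a\<close> were positive, one of the two points could be put so close to the axis
  that the bound fails.

  The argument rests on Harnack's inequality alone (\<open>Harnack_disc\<close>, \<open>Harnack_half_plane\<close>), which for
  real parts of holomorphic functions follows from the Schwarz lemma.
\<close>

section \<open>Harmonic functions as real parts of holomorphic functions\<close>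

text \<open>Two applications of the mean value theorem turn a second difference of \<open>u\<close> into a value
  of its Hessian, with the order of the arguments \<open>p\<close> and \<open>q\<close> decided by the order in which
  the theorem is applied. As the second difference is symmetric in \<open>p\<close> and \<open>q\<close>, this leads to the
  symmetry of the Hessian.\<close>

lemma second_difference_mvt:
  fixes u :: "'a::real_inner \<Rightarrow> real"
  assumes s: "0 < s"
    and sub: "\<And>x y. x \<in> {0..s} \<Longrightarrow> y \<in> {0..s} \<Longrightarrow> z + x *\<^sub>R p + y *\<^sub>R q \<in> S"
    and du: "\<And>w. w \<in> S \<Longrightarrow> (u has_derivative (\<lambda>h. g w \<bullet> h)) (at w)"
    and dg: "\<And>w. w \<in> S \<Longrightarrow> (g has_derivative H w) (at w)"
  obtains x y where "x \<in> {0..s}" "y \<in> {0..s}"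
    "u (z + s *\<^sub>R p + s *\<^sub>R q) - u (z + s *\<^sub>R p) - u (z + s *\<^sub>R q) + u z
       = s\<^sup>2 * (H (z + x *\<^sub>R p + y *\<^sub>R q) q \<bullet> p)"
proof -
  define \<phi> where "\<phi> t = u (z + t *\<^sub>R p + s *\<^sub>R q) - u (z + t *\<^sub>R p + 0 *\<^sub>R q)" for t
  have "\<exists>x\<in>{0<..<s}. \<phi> s - \<phi> 0 = (\<lambda>h. g (z + x *\<^sub>R p + s *\<^sub>R q) \<bullet> (h *\<^sub>R p)
      - g (z + x *\<^sub>R p + 0 *\<^sub>R q) \<bullet> (h *\<^sub>R p)) (s - 0)"
  proof (rule mvt_simple[OF s])
    fix t assume t: "0 \<le> t" "t \<le> s"
    have line: "((\<lambda>t. u (z + t *\<^sub>R p + y *\<^sub>R q)) has_derivative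
        (\<lambda>h. g (z + t *\<^sub>R p + y *\<^sub>R q) \<bullet> (h *\<^sub>R p))) (at t within {0..s})" if "y \<in> {0..s}" for y
      by (rule has_derivative_compose[where f = "\<lambda>t. z + t *\<^sub>R p + y *\<^sub>R q"])
        (use t that in \<open>auto intro!: derivative_eq_intros du sub\<close>)
    show "(\<phi> has_derivative (\<lambda>h. g (z + t *\<^sub>R p + s *\<^sub>R q) \<bullet> (h *\<^sub>R p)
      - g (z + t *\<^sub>R p + 0 *\<^sub>R q) \<bullet> (h *\<^sub>R p))) (at t within {0..s})"
      unfolding \<phi>_def by (intro has_derivative_diff line) (use s in auto)
  qed
  then obtain x where x: "0 < x" "x < s" and
    \<phi>: "\<phi> s - \<phi> 0 = s * (g (z + x *\<^sub>R p + s *\<^sub>R q) \<bullet> p - g (z + x *\<^sub>R p + 0 *\<^sub>R q) \<bullet> p)"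
    by (auto simp: algebra_simps)
  have "\<exists>y\<in>{0<..<s}. g (z + x *\<^sub>R p + s *\<^sub>R q) \<bullet> p - g (z + x *\<^sub>R p + 0 *\<^sub>R q) \<bullet> p
      = (\<lambda>h. H (z + x *\<^sub>R p + y *\<^sub>R q) (h *\<^sub>R q) \<bullet> p) (s - 0)"
  proof (rule mvt_simple[OF s, where f = "\<lambda>y. g (z + x *\<^sub>R p + y *\<^sub>R q) \<bullet> p"])
    fix y assume y: "0 \<le> y" "y \<le> s"
    have "((\<lambda>y. g (z + x *\<^sub>R p + y *\<^sub>R q)) has_derivative
        (\<lambda>h. H (z + x *\<^sub>R p + y *\<^sub>R q) (h *\<^sub>R q))) (at y within {0..s})"
      by (rule has_derivative_compose[where f = "\<lambda>y. z + x *\<^sub>R p + y *\<^sub>R q"])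
        (use x y in \<open>auto intro!: derivative_eq_intros dg sub\<close>)
    then show "((\<lambda>y. g (z + x *\<^sub>R p + y *\<^sub>R q) \<bullet> p) has_derivative
        (\<lambda>h. H (z + x *\<^sub>R p + y *\<^sub>R q) (h *\<^sub>R q) \<bullet> p)) (at y within {0..s})"
      by (rule has_derivative_inner_left)
  qed
  then obtain y where y: "0 < y" "y < s" and
    g: "g (z + x *\<^sub>R p + s *\<^sub>R q) \<bullet> p - g (z + x *\<^sub>R p + 0 *\<^sub>R q) \<bullet> p
      = H (z + x *\<^sub>R p + y *\<^sub>R q) (s *\<^sub>R q) \<bullet> p"
    by auto
  have "linear (H (z + x *\<^sub>R p + y *\<^sub>R q))"
    using dg[OF sub[of x y]] x y by (auto intro: has_derivative_linear)
  then have "\<phi> s - \<phi> 0 = s\<^sup>2 * (H (z + x *\<^sub>R p + y *\<^sub>R q) q \<bullet> p)"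
    unfolding \<phi> g by (simp add: linear_cmul power2_eq_square)
  then show thesis
    using that[of x y] x y by (simp add: \<phi>_def)
qed

text \<open>If the two values differed, continuity would keep \<open>H w p \<bullet> q\<close> and \<open>H w' q \<bullet> p\<close> apart
  for all \<open>w\<close> and \<open>w'\<close> near \<open>z\<close>, yet both are equal to the same second difference for
  suitable such \<open>w\<close> and \<open>w'\<close>.\<close>

lemma hessian_symmetric:
  fixes u :: "'a::real_inner \<Rightarrow> real"
  assumes S: "open S" "z \<in> S"
    and du: "\<And>w. w \<in> S \<Longrightarrow> (u has_derivative (\<lambda>h. g w \<bullet> h)) (at w)"
    and dg: "\<And>w. w \<in> S \<Longrightarrow> (g has_derivative H w) (at w)"
    and cont: "\<And>h. continuous_on S (\<lambda>w. H w h)"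
  shows "H z p \<bullet> q = H z q \<bullet> p"
proof (rule ccontr)
  define \<epsilon> where "\<epsilon> = \<bar>H z p \<bullet> q - H z q \<bullet> p\<bar> / 2"
  assume "H z p \<bullet> q \<noteq> H z q \<bullet> p"
  then have \<epsilon>: "\<epsilon> > 0" by (simp add: \<epsilon>_def)
  have near: "\<exists>r>0. \<forall>w. dist w z < r \<longrightarrow> w \<in> S \<and> \<bar>H w v \<bullet> v' - H z v \<bullet> v'\<bar> < \<epsilon>" for v v'
  proof -
    have "isCont (\<lambda>w. H w v \<bullet> v') z"
      using cont[of v] S by (intro continuous_intros) (auto simp: continuous_on_eq_continuous_at)
    then have "\<forall>\<^sub>F w in nhds z. dist (H w v \<bullet> v') (H z v \<bullet> v') < \<epsilon>"
      using \<epsilon> unfolding isCont_def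
      by (intro tendstoD tendsto_at_iff_tendsto_nhds[of "\<lambda>w. H w v \<bullet> v'" z, THEN iffD1])
    moreover have "\<forall>\<^sub>F w in nhds z. w \<in> S"
      using S by (rule eventually_nhds_in_open)
    ultimately have "\<forall>\<^sub>F w in nhds z. w \<in> S \<and> \<bar>H w v \<bullet> v' - H z v \<bullet> v'\<bar> < \<epsilon>"
      by eventually_elim (simp add: dist_real_def)
    then show ?thesis
      by (simp add: eventually_nhds_metric)
  qed
  obtain r1 where r1: "r1 > 0"
    "\<And>w. dist w z < r1 \<Longrightarrow> w \<in> S \<and> \<bar>H w p \<bullet> q - H z p \<bullet> q\<bar> < \<epsilon>"
    using near[of p q] by blast
  obtain r2 where r2: "r2 > 0"
    "\<And>w. dist w z < r2 \<Longrightarrow> w \<in> S \<and> \<bar>H w q \<bullet> p - H z q \<bullet> p\<bar> < \<epsilon>"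
    using near[of q p] by blast
  define s where "s = min r1 r2 / (1 + norm p + norm q)"
  have s: "s > 0"
    using r1(1) r2(1) by (auto simp: s_def intro!: divide_pos_pos add_pos_nonneg)
  have d: "dist (z + x *\<^sub>R a + y *\<^sub>R b) z < min r1 r2"
    if "x \<in> {0..s}" "y \<in> {0..s}" "norm a + norm b = norm p + norm q" for x y a b
  proof -
    have "dist (z + x *\<^sub>R a + y *\<^sub>R b) z \<le> x * norm a + y * norm b"
      using that norm_triangle_ineq[of "x *\<^sub>R a" "y *\<^sub>R b"] by (simp add: dist_norm add.assoc)
    also have "\<dots> \<le> s * norm a + s * norm b"
      using that by (intro add_mono mult_right_mono) auto
    also have "\<dots> = s * (norm p + norm q)"
      using that(3) by (simp flip: distrib_left)
    also have "\<dots> < s * (1 + norm p + norm q)"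
      using s by simp
    also have "\<dots> = min r1 r2"
      unfolding s_def using add_pos_nonneg[of 1 "norm p + norm q"] by (simp add: field_simps)
    finally show ?thesis .
  qed
  obtain x y where xy: "x \<in> {0..s}" "y \<in> {0..s}" and
    1: "u (z + s *\<^sub>R p + s *\<^sub>R q) - u (z + s *\<^sub>R p) - u (z + s *\<^sub>R q) + u z
       = s\<^sup>2 * (H (z + x *\<^sub>R p + y *\<^sub>R q) q \<bullet> p)"
    by (rule second_difference_mvt[OF s _ du dg, of z p q]) (use d r1 in auto)
  obtain x' y' where xy': "x' \<in> {0..s}" "y' \<in> {0..s}" and
    2: "u (z + s *\<^sub>R q + s *\<^sub>R p) - u (z + s *\<^sub>R q) - u (z + s *\<^sub>R p) + u z
       = s\<^sup>2 * (H (z + x' *\<^sub>R q + y' *\<^sub>R p) p \<bullet> q)"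
    by (rule second_difference_mvt[OF s _ du dg, of z q p]) (use d[of _ _ q p] r1 in auto)
  have "z + s *\<^sub>R q + s *\<^sub>R p = z + s *\<^sub>R p + s *\<^sub>R q" by simp
  from 2[unfolded this] 1
  have "s\<^sup>2 * (H (z + x *\<^sub>R p + y *\<^sub>R q) q \<bullet> p) = s\<^sup>2 * (H (z + x' *\<^sub>R q + y' *\<^sub>R p) p \<bullet> q)"
    by linarith
  with s have "H (z + x *\<^sub>R p + y *\<^sub>R q) q \<bullet> p = H (z + x' *\<^sub>R q + y' *\<^sub>R p) p \<bullet> q"
    by simp
  moreover have "\<bar>H (z + x *\<^sub>R p + y *\<^sub>R q) q \<bullet> p - H z q \<bullet> p\<bar> < \<epsilon>"
    using d[of x y p q] xy r2 by auto
  moreover have "\<bar>H (z + x' *\<^sub>R q + y' *\<^sub>R p) p \<bullet> q - H z p \<bullet> q\<bar> < \<epsilon>"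
    using d[of x' y' q p] xy' r1 by auto
  ultimately have "\<bar>H z p \<bullet> q - H z q \<bullet> p\<bar> < 2 * \<epsilon>"
    by linarith
  then show False
    by (simp add: \<epsilon>_def)
qed

text \<open>Symmetry of the Hessian and the vanishing of its trace are the Cauchy--Riemann equations
  for the conjugate of the gradient. Its primitive, which exists on a starlike set, has a real part with
  the same gradient as \<open>u\<close>.\<close>

lemma harmonic_on_starlike_eq_Re_holomorphic:
  assumes harm: "harmonic_on u D" and S: "open S" "starlike S" "S \<subseteq> D"
  shows "\<exists>f. f holomorphic_on S \<and> (\<forall>z\<in>S. Re (f z) = u z)"
proof -
  obtain g H where D: "open D"
    and du: "\<And>z. z \<in> D \<Longrightarrow> (u has_derivative (\<lambda>h. g z \<bullet> h)) (at z)"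
    and dg: "\<And>z. z \<in> D \<Longrightarrow> (g has_derivative H z) (at z)"
    and cont: "\<And>h. continuous_on D (\<lambda>z. H z h)"
    and lap: "\<And>z. z \<in> D \<Longrightarrow> H z 1 \<bullet> 1 + H z \<i> \<bullet> \<i> = 0"
    using harm unfolding harmonic_on_def by blast
  have diff: "(\<lambda>z. cnj (g z)) field_differentiable at z" if z: "z \<in> S" for z
  proof -
    have zD: "z \<in> D" using z S by auto
    have sym: "H z 1 \<bullet> \<i> = H z \<i> \<bullet> 1"
      by (rule hessian_symmetric[OF D zD du dg cont])
    have lin: "linear (H z)"
      using dg[OF zD] by (rule has_derivative_linear)
    have "H z h = cnj (cnj (H z 1) * h)" for h
    proof -
      have "h = Re h *\<^sub>R 1 + Im h *\<^sub>R \<i>"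
        by (simp add: complex_eq_iff)
      then have "H z h = Re h *\<^sub>R H z 1 + Im h *\<^sub>R H z \<i>"
        by (metis lin linear_add linear_cmul)
      then show ?thesis
        using sym lap[OF zD]
        by (simp add: complex_eq_iff inner_complex_def algebra_simps add_eq_0_iff)
    qed
    then have "cnj (H z h) = cnj (H z 1) * h" for h
      by (metis complex_cnj_cnj)
    then have eq: "(\<lambda>h. cnj (H z h)) = (*) (cnj (H z 1))"
      by (rule ext)
    have "((\<lambda>z. cnj (g z)) has_derivative (\<lambda>h. cnj (H z h))) (at z)"
      using dg[OF zD] by (rule has_derivative_cnj)
    then show ?thesis
      unfolding field_differentiable_def has_field_derivative_def eq by (rule exI)
  qed
  have "continuous_on S (\<lambda>z. cnj (g z))"
    by (intro continuous_at_imp_continuous_on ballI field_differentiable_imp_continuous_at diff)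
  then have "\<exists>F. \<forall>z\<in>S. (F has_field_derivative cnj (g z)) (at z)"
    using S(2,1) by (rule holomorphic_starlike_primitive[where k = "{}"]) (simp_all add: diff)
  then obtain F where F: "\<And>z. z \<in> S \<Longrightarrow> (F has_field_derivative cnj (g z)) (at z)"
    by blast
  have deriv0: "((\<lambda>z. Re (F z) - u z) has_derivative (\<lambda>h. 0)) (at z)" if z: "z \<in> S" for z
  proof -
    have "((\<lambda>z. Re (F z) - u z) has_derivative (\<lambda>h. Re (cnj (g z) * h) - g z \<bullet> h)) (at z)"
      using F[OF z] du[of z] z S unfolding has_field_derivative_def
      by (intro derivative_intros) auto
    then show ?thesis
      by (simp add: inner_complex_def)
  qed
  have "(\<lambda>z. Re (F z) - u z) constant_on S"
  proof (rule has_derivative_zero_connected_constant_on[of S "{}"])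
    show "connected S"
      using S by (simp add: starlike_imp_connected)
    show "continuous_on S (\<lambda>z. Re (F z) - u z)"
      by (intro continuous_at_imp_continuous_on ballI has_derivative_continuous[OF deriv0])
  qed (use S deriv0 in \<open>auto intro: has_derivative_at_withinI\<close>)
  then obtain c where c: "\<And>z. z \<in> S \<Longrightarrow> Re (F z) - u z = c"
    unfolding constant_on_def by blast
  show ?thesis
  proof (intro exI[of _ "\<lambda>z. F z - of_real c"] conjI)
    show "(\<lambda>z. F z - of_real c) holomorphic_on S"
      using F S by (intro holomorphic_intros) (auto simp: holomorphic_on_open)
  qed (use c in fastforce)
qed

section \<open>Harnack inequalities\<close>

text \<open>The Cayley transform \<open>\<lambda>\<zeta>. (\<zeta> - f 0) / (\<zeta> + cnj (f 0))\<close> maps the right half plane to the unit disc and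
  \<open>f 0\<close> to the origin. The Schwarz lemma for its composition with \<open>f\<close>, solved for \<open>f z\<close>, is the
  inequality.\<close>

lemma Harnack_unit_disc:
  assumes hol: "f holomorphic_on ball 0 1" and pos: "\<And>z. z \<in> ball 0 1 \<Longrightarrow> 0 < Re (f z)"
    and z: "norm z < 1"
  shows "Re (f z) \<le> (1 + norm z) / (1 - norm z) * Re (f 0)"
proof -
  define g where "g w = (f w - f 0) / (f w + cnj (f 0))" for w
  have f0: "Re (f 0) > 0" by (rule pos) simp
  have nz: "f w + cnj (f 0) \<noteq> 0" if "norm w < 1" for w
    using pos[of w] f0 that by (auto simp: complex_eq_iff)
  have "norm (g z) \<le> norm z"
  proof (rule Schwarz_Lemma(1)[OF _ _ _ z])
    show "g holomorphic_on ball 0 1"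
      unfolding g_def by (intro holomorphic_intros hol) (use nz in auto)
    show "norm (g w) < 1" if w: "norm w < 1" for w
    proof -
      have "(norm (f w - f 0))\<^sup>2 < (norm (f w + cnj (f 0)))\<^sup>2"
        using pos[of w] f0 w mult_pos_pos[of "Re (f w)" "Re (f 0)"]
        unfolding cmod_power2 by (simp add: algebra_simps power2_eq_square)
      then show ?thesis
        using nz[OF w] by (simp add: g_def norm_divide power_less_imp_less_base)
    qed
  qed (simp add: g_def)
  moreover define t where "t = norm (g z)"
  ultimately have t: "0 \<le> t" "t \<le> norm z" by auto
  have eq: "f z * (1 - g z) = f 0 + cnj (f 0) * g z"
    using nz[OF z] by (simp add: g_def field_simps)
  have g1: "1 - g z \<noteq> 0" using t z by (auto simp: t_def)
  have "f z = (f 0 + cnj (f 0) * g z) / (1 - g z)"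
    using eq g1 by (simp add: field_simps)
  then have "Re (f z) = Re ((f 0 + cnj (f 0) * g z) / (1 - g z))"
    by (rule arg_cong)
  also have "\<dots> = Re (f 0) * (1 - t\<^sup>2) / (norm (1 - g z))\<^sup>2"
    unfolding t_def Re_divide cmod_power2 by (simp add: algebra_simps power2_eq_square)
  also have "\<dots> \<le> Re (f 0) * (1 - t\<^sup>2) / (1 - t)\<^sup>2"
  proof (rule divide_left_mono)
    show "(1 - t)\<^sup>2 \<le> (norm (1 - g z))\<^sup>2"
      using norm_triangle_ineq2[of 1 "g z"] t z by (intro power_mono) (auto simp: t_def)
    show "0 \<le> Re (f 0) * (1 - t\<^sup>2)"
      using f0 t z by (intro mult_nonneg_nonneg) (auto simp: power_le_one)
    show "0 < (norm (1 - g z))\<^sup>2 * (1 - t)\<^sup>2"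
      using g1 t z by auto
  qed
  also have "\<dots> = (1 + t) / (1 - t) * Re (f 0)"
  proof -
    have "1 - t\<^sup>2 = (1 + t) * (1 - t)"
      by (simp add: power2_eq_square algebra_simps)
    then show ?thesis
      using t z by (simp add: power2_eq_square)
  qed
  also have "\<dots> \<le> (1 + norm z) / (1 - norm z) * Re (f 0)"
    using f0 t z by (intro mult_right_mono frac_le) auto
  finally show ?thesis .
qed

lemma Harnack_disc:
  assumes hol: "f holomorphic_on ball c r" and pos: "\<And>z. z \<in> ball c r \<Longrightarrow> 0 < Re (f z)"
    and z: "z \<in> ball c r"
  shows "Re (f z) \<le> (r + dist c z) / (r - dist c z) * Re (f c)"
proof -
  have r: "r > 0" using z by (auto simp: mem_ball intro: le_less_trans[OF zero_le_dist])
  have in_ball: "c + of_real r * w \<in> ball c r" if "norm w < 1" for w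
    using that r by (simp add: dist_norm norm_mult)
  have "Re (f (c + of_real r * ((z - c) / of_real r))) \<le>
      (1 + norm ((z - c) / of_real r)) / (1 - norm ((z - c) / of_real r)) * Re (f (c + of_real r * 0))"
  proof (rule Harnack_unit_disc[of "\<lambda>w. f (c + of_real r * w)"])
    have "(f \<circ> (\<lambda>w. c + of_real r * w)) holomorphic_on ball 0 1"
      by (rule holomorphic_on_compose_gen[OF _ hol]) (use in_ball in \<open>auto intro!: holomorphic_intros\<close>)
    then show "(\<lambda>w. f (c + of_real r * w)) holomorphic_on ball 0 1"
      by (simp add: o_def)
  qed (use in_ball pos z r in \<open>auto simp: dist_norm norm_minus_commute norm_divide\<close>)
  moreover have "(1 + norm ((z - c) / of_real r)) / (1 - norm ((z - c) / of_real r))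
      = (r + dist c z) / (r - dist c z)"
    using r z by (simp add: norm_divide dist_norm norm_minus_commute field_simps)
  ultimately show ?thesis
    using r by simp
qed

text \<open>The optimal factor here is \<open>(A + B) / (A - B)\<close> with \<open>A = \<bar>w + cnj v\<bar>\<close> and \<open>B = \<bar>w - v\<bar>\<close>. The
  cruder one still grows only like \<open>\<bar>w\<bar>\<close> when \<open>w\<close> moves out along a ray, the order of growth that a
  comparison of \<open>Re f\<close> with \<open>Re w\<close> requires. Only \<open>Re f \<ge> 0\<close> is assumed, because the lemma will be
  applied after a multiple of \<open>w\<close> has been subtracted; adding a small positive constant
  \<open>\<delta>\<close> reduces this to the case of a positive real part.\<close>

lemma Harnack_half_plane:
  assumes hol: "f holomorphic_on {w. 0 < Re w}" and nonneg: "\<And>w. 0 < Re w \<Longrightarrow> 0 \<le> Re (f w)"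
    and w: "0 < Re w" and v: "0 < Re v"
  shows "Re (f w) \<le> (norm w + norm v)\<^sup>2 / (Re w * Re v) * Re (f v)"
proof -
  \<comment> \<open>\<open>T\<close> maps the unit disc onto the half plane, with \<open>T 0 = v\<close>; \<open>\<zeta>\<close> is the preimage of \<open>w\<close>.\<close>
  define T where "T \<zeta> = (v + cnj v * \<zeta>) / (1 - \<zeta>)" for \<zeta>
  define \<zeta> where "\<zeta> = (w - v) / (w + cnj v)"
  have nz: "w + cnj v \<noteq> 0"
    using w v by (auto simp: complex_eq_iff)
  have sq: "(norm (w + cnj v))\<^sup>2 - (norm (w - v))\<^sup>2 = 4 * Re w * Re v"
    unfolding cmod_power2 by (simp add: algebra_simps power2_eq_square)
  have less: "norm (w - v) < norm (w + cnj v)"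
  proof (rule power_less_imp_less_base[where n = 2])
    show "(norm (w - v))\<^sup>2 < (norm (w + cnj v))\<^sup>2"
      using sq mult_pos_pos[OF w v] by linarith
  qed simp
  have n\<zeta>: "norm \<zeta> < 1"
    using less nz by (simp add: \<zeta>_def norm_divide)
  have T\<zeta>: "T \<zeta> = w"
  proof -
    have "v + cnj v \<noteq> 0" using v by (auto simp: complex_eq_iff)
    then have "1 - \<zeta> \<noteq> 0" "(v + cnj v * \<zeta>) = w * (1 - \<zeta>)"
      using nz by (auto simp: \<zeta>_def field_simps)
    then show ?thesis by (simp add: T_def)
  qed
  have ReT: "0 < Re (T \<xi>)" if \<xi>: "norm \<xi> < 1" for \<xi>
  proof -
    have "Re (T \<xi>) = Re v * (1 - (norm \<xi>)\<^sup>2) / (norm (1 - \<xi>))\<^sup>2"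
      unfolding T_def Re_divide cmod_power2 by (simp add: algebra_simps power2_eq_square)
    moreover have "1 - \<xi> \<noteq> 0" using \<xi> by auto
    moreover have "(norm \<xi>)\<^sup>2 < 1" using \<xi> by (simp add: power_less_one_iff)
    ultimately show ?thesis using v by simp
  qed
  have T_hol: "T holomorphic_on ball 0 1"
    unfolding T_def by (intro holomorphic_intros) auto
  define A where "A = norm (w + cnj v)"
  define B where "B = norm (w - v)"
  have AB: "0 \<le> B" "B < A" "A\<^sup>2 - B\<^sup>2 = 4 * Re w * Re v"
    using less sq by (auto simp: A_def B_def)
  have fac: "(1 + norm \<zeta>) / (1 - norm \<zeta>) \<le> (norm w + norm v)\<^sup>2 / (Re w * Re v)"
  proof -
    have "(1 + norm \<zeta>) / (1 - norm \<zeta>) = (A + B) / (A - B)"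
      using AB by (simp add: \<zeta>_def norm_divide flip: A_def B_def) (simp add: field_simps)
    also have "\<dots> = (A + B)\<^sup>2 / (A\<^sup>2 - B\<^sup>2)"
    proof -
      have "A\<^sup>2 - B\<^sup>2 = (A + B) * (A - B)" by (simp add: power2_eq_square algebra_simps)
      then show ?thesis using AB(1,2) by (simp add: power2_eq_square)
    qed
    also have "\<dots> \<le> (2 * (norm w + norm v))\<^sup>2 / (A\<^sup>2 - B\<^sup>2)"
    proof (intro divide_right_mono power_mono)
      show "A + B \<le> 2 * (norm w + norm v)"
        using norm_triangle_ineq[of w "cnj v"] norm_triangle_ineq4[of w v] by (simp add: A_def B_def)
    qed (use AB w v in auto)
    also have "\<dots> = (norm w + norm v)\<^sup>2 / (Re w * Re v)"
      unfolding AB(3) power_mult_distrib by simp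
    finally show ?thesis .
  qed
  have shifted: "Re (f w) + \<delta> \<le> (norm w + norm v)\<^sup>2 / (Re w * Re v) * (Re (f v) + \<delta>)" if \<delta>: "\<delta> > 0" for \<delta>
  proof -
    have "Re (f (T \<zeta>) + of_real \<delta>) \<le> (1 + norm \<zeta>) / (1 - norm \<zeta>) * Re (f (T 0) + of_real \<delta>)"
    proof (rule Harnack_unit_disc[of "\<lambda>\<xi>. f (T \<xi>) + of_real \<delta>"])
      have "(f \<circ> T) holomorphic_on ball 0 1"
        by (rule holomorphic_on_compose_gen[OF T_hol hol]) (use ReT in auto)
      then show "(\<lambda>\<xi>. f (T \<xi>) + of_real \<delta>) holomorphic_on ball 0 1"
        unfolding o_def by (intro holomorphic_on_add holomorphic_on_const)
      show "0 < Re (f (T \<xi>) + of_real \<delta>)" if "\<xi> \<in> ball 0 1" for \<xi>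
        using nonneg[OF ReT[of \<xi>]] that \<delta> by simp
    qed (rule n\<zeta>)
    also have "\<dots> \<le> (norm w + norm v)\<^sup>2 / (Re w * Re v) * Re (f (T 0) + of_real \<delta>)"
      using nonneg[OF v] \<delta> by (intro mult_right_mono fac) (auto simp: T_def)
    finally show ?thesis
      using T\<zeta> by (simp add: T_def)
  qed
  show ?thesis
  proof (rule tendsto_le[of "at_right 0"])
    show "((\<lambda>\<delta>. Re (f w) + \<delta>) \<longlongrightarrow> Re (f w)) (at_right 0)"
      by (auto intro!: tendsto_eq_intros)
    show "((\<lambda>\<delta>. (norm w + norm v)\<^sup>2 / (Re w * Re v) * (Re (f v) + \<delta>)) \<longlongrightarrow>
        (norm w + norm v)\<^sup>2 / (Re w * Re v) * Re (f v)) (at_right 0)"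
      using w v by (auto intro!: tendsto_eq_intros)
    show "\<forall>\<^sub>F \<delta> in at_right 0. Re (f w) + \<delta> \<le> (norm w + norm v)\<^sup>2 / (Re w * Re v) * (Re (f v) + \<delta>)"
      using eventually_at_right_less[of 0] by eventually_elim (rule shifted)
  qed simp
qed

section \<open>The angular derivative at infinity\<close>

text \<open>Subtracting the largest multiple \<open>a * w\<close> that keeps the real part nonnegative leaves a
  function \<open>p\<close> for which \<open>Re (p v) / Re v\<close> has infimum zero. The Harnack inequality propagates a small
  value of this quotient at one point \<open>v\<close> to all large real numbers \<open>x\<close>, as its factor there is
  \<open>((x + \<bar>v\<bar>) / x)\<^sup>2 * x / Re v\<close>. Applied once more, from \<open>x\<close> to \<open>x * w\<close>, it gives the claim
  on every ray, because the factor is then independent of \<open>x\<close>.\<close>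

lemma angular_derivative_at_infinity:
  assumes hol: "f holomorphic_on {w. 0 < Re w}" and nonneg: "\<And>w. 0 < Re w \<Longrightarrow> 0 \<le> Re (f w)"
  shows "\<exists>a\<ge>0. \<forall>w. 0 < Re w \<longrightarrow> ((\<lambda>x. Re (f (of_real x * w)) / x) \<longlongrightarrow> a * Re w) at_top"
proof -
  define Q where "Q = (\<lambda>w. Re (f w) / Re w) ` {w. 0 < Re w}"
  define a where "a = Inf Q"
  have Q: "Q \<noteq> {}" "\<And>q. q \<in> Q \<Longrightarrow> 0 \<le> q"
    using nonneg by (auto simp: Q_def intro!: exI[of _ 1])
  then have a: "0 \<le> a"
    unfolding a_def by (intro cInf_greatest) auto
  have le: "a * Re w \<le> Re (f w)" if w: "0 < Re w" for w
  proof -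
    have "a \<le> Re (f w) / Re w"
      unfolding a_def by (rule cInf_lower) (use Q w in \<open>auto simp: Q_def intro!: bdd_belowI[of _ 0]\<close>)
    then show ?thesis using w by (simp add: field_simps)
  qed
  define p where "p w = f w - of_real a * w" for w
  have p_hol: "p holomorphic_on {w. 0 < Re w}"
    unfolding p_def by (intro holomorphic_intros hol)
  have p_nonneg: "0 \<le> Re (p w)" if "0 < Re w" for w
    using le[OF that] by (simp add: p_def)
  have lim_real: "((\<lambda>x. Re (p (of_real x)) / x) \<longlongrightarrow> 0) at_top"
  proof (rule order_tendstoI)
    fix e :: real assume e: "0 < e"
    then have "Inf Q < a + e" by (simp add: a_def)
    then obtain v where v: "0 < Re v" "Re (f v) / Re v < a + e"
      using cInf_lessD[OF Q(1)] by (auto simp: Q_def)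
    then have pv: "Re (p v) / Re v < e"
      by (simp add: p_def field_simps)
    have "((\<lambda>x. ((x + norm v) / x)\<^sup>2 * (Re (p v) / Re v)) \<longlongrightarrow> (1 + 0)\<^sup>2 * (Re (p v) / Re v)) at_top"
    proof (intro tendsto_intros)
      have "((\<lambda>x. 1 + norm v / x) \<longlongrightarrow> 1 + 0) at_top"
        by (intro tendsto_add tendsto_const real_tendsto_divide_at_top[OF tendsto_const] filterlim_ident)
      moreover have "\<forall>\<^sub>F x in at_top. 1 + norm v / x = (x + norm v) / x"
        using eventually_gt_at_top[of 0] by eventually_elim (simp add: field_simps)
      ultimately show "((\<lambda>x. (x + norm v) / x) \<longlongrightarrow> 1 + 0) at_top"
        by (rule Lim_transform_eventually)
    qed
    then have "\<forall>\<^sub>F x in at_top. ((x + norm v) / x)\<^sup>2 * (Re (p v) / Re v) < e"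
      by (rule order_tendstoD) (use pv in simp)
    then show "\<forall>\<^sub>F x in at_top. Re (p (of_real x)) / x < e"
      using eventually_gt_at_top[of 0]
    proof eventually_elim
      case (elim x)
      have "Re (p (of_real x)) \<le> (norm (of_real x :: complex) + norm v)\<^sup>2 / (Re (of_real x) * Re v) * Re (p v)"
        by (rule Harnack_half_plane[OF p_hol p_nonneg]) (use elim v in auto)
      then have "Re (p (of_real x)) / x \<le> ((x + norm v)\<^sup>2 / (x * Re v) * Re (p v)) / x"
        using elim by (intro divide_right_mono) auto
      also have "\<dots> = ((x + norm v) / x)\<^sup>2 * (Re (p v) / Re v)"
        by (simp add: power2_eq_square)
      finally show ?case using elim by simp
    qed
  next
    fix e :: real assume "e < 0"
    show "\<forall>\<^sub>F x in at_top. e < Re (p (of_real x)) / x"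
      using eventually_gt_at_top[of 0]
    proof eventually_elim
      case (elim x)
      then have "0 \<le> Re (p (of_real x)) / x"
        using p_nonneg[of "of_real x"] by simp
      with \<open>e < 0\<close> show ?case by simp
    qed
  qed
  show ?thesis
  proof (intro exI[of _ a] conjI a allI impI)
    fix w :: complex assume w: "0 < Re w"
    define C where "C = (norm w + 1)\<^sup>2 / Re w"
    have "((\<lambda>x. Re (p (of_real x * w)) / x) \<longlongrightarrow> 0) at_top"
    proof (rule tendsto_sandwich[where f = "\<lambda>_. 0"])
      show "\<forall>\<^sub>F x in at_top. 0 \<le> Re (p (of_real x * w)) / x"
        using eventually_gt_at_top[of 0] by eventually_elim (use p_nonneg w in auto)
      show "\<forall>\<^sub>F x in at_top. Re (p (of_real x * w)) / x \<le> C * (Re (p (of_real x)) / x)"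
        using eventually_gt_at_top[of 0]
      proof eventually_elim
        case (elim x)
        have "Re (p (of_real x * w)) \<le> (norm (of_real x * w) + norm (of_real x :: complex))\<^sup>2
            / (Re (of_real x * w) * Re (of_real x)) * Re (p (of_real x))"
          by (rule Harnack_half_plane[OF p_hol p_nonneg]) (use elim w in auto)
        also have "(norm (of_real x * w) + norm (of_real x :: complex))\<^sup>2
            / (Re (of_real x * w) * Re (of_real x)) = C"
        proof -
          have "norm (of_real x * w) + norm (of_real x :: complex) = x * (norm w + 1)"
            using elim by (simp add: norm_mult algebra_simps)
          then show ?thesis
            using elim w by (simp add: C_def power2_eq_square)
        qed
        finally show ?case
          using elim by (simp add: field_simps)
      qed
      show "((\<lambda>x. C * (Re (p (of_real x)) / x)) \<longlongrightarrow> 0) at_top"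
        using tendsto_mult_right_zero[OF lim_real] .
    qed simp
    from tendsto_add[OF this tendsto_const[of "a * Re w"]]
    have "((\<lambda>x. Re (p (of_real x * w)) / x + a * Re w) \<longlongrightarrow> a * Re w) at_top"
      by simp
    moreover have "\<forall>\<^sub>F x in at_top. Re (p (of_real x * w)) / x + a * Re w = Re (f (of_real x * w)) / x"
      using eventually_gt_at_top[of 0] by eventually_elim (simp add: p_def field_simps)
    ultimately show "((\<lambda>x. Re (f (of_real x * w)) / x) \<longlongrightarrow> a * Re w) at_top"
      by (rule Lim_transform_eventually)
  qed
qed

section \<open>Long gaps\<close>

lemma frequently_of_less_limsup:
  fixes X :: "nat \<Rightarrow> ereal"
  assumes "l < limsup X"
  shows "\<exists>\<^sub>F n in sequentially. l < X n"
  unfolding frequently_def using assms Limsup_bounded[of X l sequentially]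
  by (auto simp: not_less)

text \<open>If the endpoints stayed bounded, then they would converge, both \<open>c n\<close> and \<open>d n\<close> to the same positive limit,
  and \<open>d n / c n\<close> would tend to one.\<close>

lemma gap_endpoints_at_top:
  fixes c d :: "nat \<Rightarrow> real"
  assumes c0: "0 \<le> c 0" and cd: "\<And>n. c n < d n" and dc: "\<And>n. d n < c (Suc n)"
    and q: "1 < q" and freq: "\<exists>\<^sub>F n in sequentially. q < d n / c n"
  shows "filterlim c at_top sequentially"
proof -
  have step: "c n < c (Suc n)" for n
    using cd[of n] dc[of n] by simp
  then have mono: "incseq c"
    by (auto intro!: incseq_SucI less_imp_le)
  have "\<not> bdd_above (range c)"
  proof
    assume "bdd_above (range c)"
    then have lim: "c \<longlonglongrightarrow> (SUP n. c n)" and le: "c n \<le> (SUP n. c n)" for n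
      using mono by (auto intro: LIMSEQ_incseq_SUP cSUP_upper)
    define l where "l = (SUP n. c n)"
    have l: "0 < l"
      using c0 step[of 0] le[of 1] by (simp add: l_def)
    then have "l / q < l"
      using q by (simp add: field_simps)
    then have "\<forall>\<^sub>F n in sequentially. l / q < c n"
      using lim by (auto simp: l_def intro: order_tendstoD)
    then have "\<forall>\<^sub>F n in sequentially. \<not> q < d n / c n"
    proof eventually_elim
      case (elim n)
      then have "0 < c n" "l < q * c n"
        using l q by (auto simp: field_simps intro: less_trans[of 0 "l / q"])
      then show ?case
        using dc[of n] le[of "Suc n"] by (simp add: field_simps l_def)
    qed
    with freq show False
      by (simp add: frequently_def)
  qed
  then show ?thesis
    using mono unfolding filterlim_at_top bdd_above_def eventually_sequentially
    by (auto simp: not_le) (meson incseqD less_imp_le order_trans)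
qed

section \<open>The growth of functions with infinitely many long gaps\<close>

theorem theorem1p5:
  fixes u :: "complex \<Rightarrow> real" and E :: "complex set" and c d :: "nat \<Rightarrow> real"
  assumes "class_K u E"
    and "(\<Union>n. complex_of_real ` {- d n<..<- c n}) \<subseteq> - E"
    and "0 \<le> c 0" and "\<And>n. c n < d n" and "\<And>n. d n < c (Suc n)"
    and "limsup (\<lambda>n. ereal (d n / c n)) > 1"
  shows "((\<lambda>r. u (complex_of_real r) / sqrt r) \<longlongrightarrow> 0) at_top"
proof -
  have E: "closed E" "E \<subseteq> complex_of_real ` {..0}"
    and harm: "harmonic_on u (- E)" and pos: "\<And>z. z \<notin> E \<Longrightarrow> 0 < u z"
    using assms(1) by (auto simp: class_K_def)
  define S where "S = - complex_of_real ` {..0}"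
  have "open S"
    unfolding S_def by (intro open_Compl closed_slot_left)
  then obtain F where F: "F holomorphic_on S" "\<And>z. z \<in> S \<Longrightarrow> Re (F z) = u z"
    using harmonic_on_starlike_eq_Re_holomorphic[OF harm, of S] E
      starlike_slotted_complex_plane_left[of 0] by (auto simp: S_def)
  have sq: "w\<^sup>2 \<in> S" if w: "0 < Re w" for w
    using w by (auto simp: S_def complex_slot_left_eq Re_power2 Im_power2)
  define f where "f w = F (w\<^sup>2)" for w
  have Re_f: "Re (f w) = u (w\<^sup>2)" if "0 < Re w" for w
    using F(2)[OF sq[OF that]] by (simp add: f_def)
  have "(F \<circ> (\<lambda>w. w\<^sup>2)) holomorphic_on {w. 0 < Re w}"
    by (rule holomorphic_on_compose_gen[OF _ F(1)]) (use sq in \<open>auto intro!: holomorphic_intros\<close>)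
  then have "f holomorphic_on {w. 0 < Re w}"
    by (simp add: f_def[abs_def] o_def)
  moreover have "0 \<le> Re (f w)" if "0 < Re w" for w
  proof -
    have "w\<^sup>2 \<notin> E"
      using sq[OF that] E(2) by (auto simp: S_def)
    then show ?thesis
      using Re_f[OF that] pos[of "w\<^sup>2"] by simp
  qed
  ultimately have "\<exists>a\<ge>0. \<forall>w. 0 < Re w \<longrightarrow> ((\<lambda>x. Re (f (of_real x * w)) / x) \<longlongrightarrow> a * Re w) at_top"
    by (rule angular_derivative_at_infinity)
  then obtain a where "0 \<le> a" and
    a: "\<And>w. 0 < Re w \<Longrightarrow> ((\<lambda>x. Re (f (of_real x * w)) / x) \<longlongrightarrow> a * Re w) at_top"
    by blast

  obtain q where q: "1 < q" "ereal q < limsup (\<lambda>n. ereal (d n / c n))"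
    using ereal_dense2[OF assms(6)] by (auto simp: one_ereal_def)
  have freq: "\<exists>\<^sub>F n in sequentially. q < d n / c n"
    using frequently_of_less_limsup[OF q(2)] by simp
  have c_top: "filterlim c at_top sequentially"
    by (rule gap_endpoints_at_top[OF assms(3-5) q(1) freq])

  \<comment> \<open>\<open>(-q, -1)\<close> has midpoint \<open>-m\<close> and half length \<open>\<kappa>\<close>. The squares of the points \<open>W t\<close> of the half plane
    tend to the midpoint as \<open>t\<close> tends to zero; \<open>\<eta>\<close> is chosen so small that they lie within \<open>\<kappa> / 4\<close>
    of it when \<open>t \<le> \<eta>\<close>.\<close>
  define m where "m = (1 + q) / 2"
  define \<kappa> where "\<kappa> = (q - 1) / 2"
  have m: "0 < m" and \<kappa>: "0 < \<kappa>"
    using q by (auto simp: m_def \<kappa>_def)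
  define W where "W t = Complex t (sqrt m)" for t
  define \<eta> where "\<eta> = min 1 (\<kappa> / (8 * (1 + 2 * sqrt m)))"
  have \<eta>: "0 < \<eta>"
    using \<kappa> m by (auto simp: \<eta>_def intro!: divide_pos_pos add_pos_nonneg)
  have close: "norm ((W t)\<^sup>2 + of_real m) < \<kappa> / 4" if t: "0 < t" "t \<le> \<eta>" for t
  proof -
    have "(W t)\<^sup>2 + of_real m = of_real (t\<^sup>2) + \<i> * of_real (2 * t * sqrt m)"
      using m by (simp add: W_def complex_eq_iff Re_power2 Im_power2)
    also have "norm \<dots> \<le> t\<^sup>2 + 2 * t * sqrt m"
      using norm_triangle_ineq[of "of_real (t\<^sup>2)" "\<i> * of_real (2 * t * sqrt m)"] t m
      by (simp add: norm_mult norm_power)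
    also have "\<dots> = t * (t + 2 * sqrt m)"
      by (simp add: power2_eq_square algebra_simps)
    also have "\<dots> \<le> \<eta> * (1 + 2 * sqrt m)"
      using t m by (intro mult_mono) (auto simp: \<eta>_def)
    also have "\<dots> \<le> \<kappa> / (8 * (1 + 2 * sqrt m)) * (1 + 2 * sqrt m)"
      using m by (intro mult_right_mono) (auto simp: \<eta>_def)
    also have "\<dots> = \<kappa> / 8"
    proof -
      have "1 + 2 * sqrt m > 0"
        using m by (simp add: add_pos_nonneg)
      then show ?thesis by (simp add: divide_simps)
    qed
    also have "\<dots> < \<kappa> / 4"
      using \<kappa> by simp
    finally show ?thesis .
  qed

  \<comment> \<open>The disc around \<open>z1\<close> with radius \<open>3 / 4\<close> of \<open>\<rho>\<close> still lies in the disc with diameter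
    \<open>(- q * c n, - c n)\<close>, and \<open>z2\<close> is at distance less than \<open>\<rho> / 2\<close> from \<open>z1\<close>, whence the factor
    \<open>(3/4 + 1/2) / (3/4 - 1/2) = 5\<close>.\<close>
  have compare: "u (of_real (c n) * (W \<eta>)\<^sup>2) \<le> 5 * u (of_real (c n) * (W (\<eta> / 10))\<^sup>2)"
    if n: "0 < c n" "q < d n / c n" for n
  proof -
    define x where "x = c n"
    define z1 where "z1 = of_real x * (W (\<eta> / 10))\<^sup>2"
    define z2 where "z2 = of_real x * (W \<eta>)\<^sup>2"
    define z0 where "z0 = - complex_of_real (x * m)"
    have x: "0 < x" "q * x < d n"
      using n by (auto simp: x_def field_simps)
    define \<rho> where "\<rho> = x * \<kappa>"
    have \<rho>: "0 < \<rho>" using x \<kappa> by (simp add: \<rho>_def)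
    have near: "dist z0 (of_real x * (W t)\<^sup>2) < \<rho> / 4" if "0 < t" "t \<le> \<eta>" for t
    proof -
      have "dist z0 (of_real x * (W t)\<^sup>2) = norm (of_real x * ((W t)\<^sup>2 + of_real m))"
        unfolding dist_commute[of z0] by (simp add: z0_def dist_norm algebra_simps)
      also have "\<dots> = x * norm ((W t)\<^sup>2 + of_real m)"
        using x by (simp add: norm_mult)
      also have "\<dots> < x * (\<kappa> / 4)"
        using close[OF that] x by (intro mult_strict_left_mono)
      finally show ?thesis by (simp add: \<rho>_def)
    qed
    have z1: "dist z0 z1 < \<rho> / 4" and z2: "dist z0 z2 < \<rho> / 4"
      unfolding z1_def z2_def using near[of "\<eta> / 10"] near[of \<eta>] \<eta> by simp_all
    have sub: "ball z1 (3 * \<rho> / 4) \<subseteq> - E"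
    proof
      fix z assume "z \<in> ball z1 (3 * \<rho> / 4)"
      then have z: "dist z0 z < \<rho>"
        using z1 dist_triangle[of z0 z z1] by simp
      show "z \<in> - E"
      proof
        assume zE: "z \<in> E"
        then obtain t where t: "z = of_real t"
          using E by blast
        have "dist z0 z = \<bar>t + x * m\<bar>"
        proof -
          have "z0 - z = of_real (- (t + x * m))" by (simp add: z0_def t)
          then show ?thesis by (simp only: dist_norm norm_of_real abs_minus_cancel)
        qed
        with z have "\<bar>t + x * m\<bar> < x * \<kappa>" by (simp add: \<rho>_def)
        then have "- (x * q) < t" "t < - x"
          by (auto simp: m_def \<kappa>_def abs_less_iff field_simps)
        with x have "t \<in> {- d n<..<- c n}"
          by (auto simp: x_def mult.commute)
        then show False
          using assms(2) zE t by blast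
      qed
    qed
    have "starlike (ball z1 (3 * \<rho> / 4))"
      using \<rho> by (intro convex_imp_starlike) auto
    then obtain G where G: "G holomorphic_on ball z1 (3 * \<rho> / 4)"
      "\<And>z. z \<in> ball z1 (3 * \<rho> / 4) \<Longrightarrow> Re (G z) = u z"
      using harmonic_on_starlike_eq_Re_holomorphic[OF harm open_ball _ sub] by blast
    have d12: "dist z1 z2 < \<rho> / 2"
      using z1 z2 dist_triangle3[of z1 z2 z0] by (simp)
    have Gpos: "0 < Re (G z)" if "z \<in> ball z1 (3 * \<rho> / 4)" for z
      using that G(2)[of z] sub pos[of z] by (auto)
    have "Re (G z2) \<le> (3 * \<rho> / 4 + dist z1 z2) / (3 * \<rho> / 4 - dist z1 z2) * Re (G z1)"
      by (rule Harnack_disc[OF _ Gpos]) (use G d12 \<rho> in \<open>auto\<close>)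
    also have "\<dots> \<le> 5 * Re (G z1)"
      using d12 \<rho> Gpos[of z1] by (intro mult_right_mono) (auto simp: field_simps)
    finally have "u z2 \<le> 5 * u z1"
      using G(2)[of z1] G(2)[of z2] d12 \<rho> by (simp)
    then show ?thesis
      by (simp add: z1_def z2_def x_def)
  qed

  have "a = 0"
  proof (rule ccontr)
    assume "a \<noteq> 0"
    with \<open>0 \<le> a\<close> have "a > 0" by simp
    have seq: "(\<lambda>n. u (of_real (c n) * (W t)\<^sup>2) / sqrt (c n)) \<longlonglongrightarrow> a * t" if t: "0 < t" for t
    proof -
      have "(\<lambda>n. Re (f (of_real (sqrt (c n)) * W t)) / sqrt (c n)) \<longlonglongrightarrow> a * Re (W t)"
        by (rule filterlim_compose[OF a filterlim_compose[OF sqrt_at_top c_top]])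
          (use t in \<open>simp add: W_def\<close>)
      moreover have "\<forall>\<^sub>F n in sequentially. Re (f (of_real (sqrt (c n)) * W t)) / sqrt (c n)
          = u (of_real (c n) * (W t)\<^sup>2) / sqrt (c n)"
        using filterlim_at_top_dense[THEN iffD1, OF c_top, rule_format, of 0]
      proof eventually_elim
        case (elim n)
        have "(of_real (sqrt (c n)) * W t)\<^sup>2 = of_real (c n) * (W t)\<^sup>2"
          using elim by (simp add: power_mult_distrib flip: of_real_power)
        then show ?case
          using Re_f[of "of_real (sqrt (c n)) * W t"] elim t by (simp add: W_def)
      qed
      ultimately have "(\<lambda>n. u (of_real (c n) * (W t)\<^sup>2) / sqrt (c n)) \<longlonglongrightarrow> a * Re (W t)"
        by (rule Lim_transform_eventually)
      then show ?thesis
        by (simp add: W_def)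
    qed
    \<comment> \<open>In the limit, \<open>compare\<close> would give \<open>a * \<eta> \<le> 5 * (a * (\<eta> / 10)) = a * \<eta> / 2\<close>.\<close>
    have "(\<lambda>n. u (of_real (c n) * (W \<eta>)\<^sup>2) / sqrt (c n)
        - 5 * (u (of_real (c n) * (W (\<eta> / 10))\<^sup>2) / sqrt (c n)))
        \<longlonglongrightarrow> a * \<eta> - 5 * (a * (\<eta> / 10))"
      using \<eta> by (intro tendsto_intros seq) auto
    moreover have "0 < a * \<eta> - 5 * (a * (\<eta> / 10))"
      using \<open>a > 0\<close> \<eta> by simp
    ultimately have "\<forall>\<^sub>F n in sequentially. 0 < u (of_real (c n) * (W \<eta>)\<^sup>2) / sqrt (c n)
        - 5 * (u (of_real (c n) * (W (\<eta> / 10))\<^sup>2) / sqrt (c n))"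
      by (rule order_tendstoD)
    then have "\<forall>\<^sub>F n in sequentially. \<not> q < d n / c n"
      using filterlim_at_top_dense[THEN iffD1, OF c_top, rule_format, of 0]
    proof eventually_elim
      case (elim n)
      then have "5 * u (of_real (c n) * (W (\<eta> / 10))\<^sup>2) < u (of_real (c n) * (W \<eta>)\<^sup>2)"
        by (simp add: field_simps)
      with compare[of n] elim show ?case by linarith
    qed
    with freq show False
      by (simp add: frequently_def)
  qed
  then have "((\<lambda>r. Re (f (of_real (sqrt r) * 1)) / sqrt r) \<longlongrightarrow> 0) at_top"
    using filterlim_compose[OF a[of 1] sqrt_at_top] by simp
  moreover have "\<forall>\<^sub>F r in at_top. Re (f (of_real (sqrt r) * 1)) / sqrt r = u (of_real r) / sqrt r"
    using eventually_gt_at_top[of 0]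
  proof eventually_elim
    case (elim r)
    then show ?case
      using Re_f[of "of_real (sqrt r)"] by (simp flip: of_real_power)
  qed
  ultimately show ?thesis
    by (rule Lim_transform_eventually)
qed

end
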